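(* Let $G$ be an amenable topological group with no non-trivial continuous homomorphisms $G\to\mathbb{R}$ and let $\alpha: G\curvearrowright V$ be a continuous affine isometric action on a Banach space $V$ with associated linear isometric action $\pi:G\curvearrowright V$. Then $$V_G:=\overline{\mathrm{span}}\{v-\pi(g)v\mid v\in V,\ g\in G\}=\{v\in V\mid 0\in\overline{\pi(\Delta G)v}\}$$ is a closed linear subspace of $V$ invariant under the affine action $\alpha$.
   Context: A topological group $G$ is amenable if every continuous affine action of $G$ on a non-empty compact convex subset of a locally convex topological vector space has a fixed point. Equivalently, there is a mean $\mathfrak m$ (positive linear functional of norm $1$ with $\mathfrak m(\mathbf 1)=1$) on the algebra $\mathsf{LUCB}(G)$ of bounded functions $\phi:G\to\mathbb R$ for which $g\mapsto\phi(\,\cdot\,g)$ is continuous in the sup norm, such that $\mathfrak m(\phi(\,\cdot\, g))=\mathfrak m(\phi)$ for all $g\in G$. Banach spaces are real. Every continuous action $\alpha$ of $G$ by affine isometries on $V$ decomposes uniquely as $\alpha(g)v=\pi(g)v+b(g)$, where $\pi:G\curvearrowright V$ is a strongly continuous linear isometric action and $b:G\to V$ is continuous (a cocycle). $\Delta G$ is the set of finite convex combinations $\beta=\sum_i\lambda_ig_i$ in the real group algebra $\mathbb{R}G$, $\pi(\beta)=\sum_i\lambda_i\pi(g_i)$, and $\pi(\Delta G)v=\{\pi(\beta)v\mid\beta\in\Delta G\}$. Closures are in the norm topology. *)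

theory Defs
  imports "HOL-Analysis.Analysis" "HOL-Library.Poly_Mapping"
begin

text \<open>
  Topological groups are types of class \<open>topological_group_add\<close>.  They are written additively,
  but are neither assumed to be commutative nor to be Hausdorff: the product \<open>g h\<close> is \<open>g + h\<close>,
  the identity is \<open>0\<close>, and the right translate \<open>\<phi>(\<cdot> g)\<close> is \<open>\<lambda>x. \<phi> (x + g)\<close>.
\<close>

text \<open>
  Convergence in the sup norm is uniform convergence on \<open>UNIV\<close>.  Continuity of \<open>\<phi>\<close> itself
  is implied (evaluate the translates at \<open>0\<close>).
\<close>

definition LUCB :: "('g::topological_group_add \<Rightarrow> real) set" where
  "LUCB = {\<phi>. bounded (range \<phi>) \<and>
    (\<forall>g. uniform_limit UNIV (\<lambda>h x. \<phi> (x + h)) (\<lambda>x. \<phi> (x + g)) (nhds g))}"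

text \<open>Only the values of \<open>m\<close> on \<open>LUCB\<close> matter.  The last two conjuncts of
  \<open>mean_on_LUCB\<close> together say that \<open>m\<close> has norm \<open>1\<close> and takes the value \<open>1\<close> at \<open>1\<close>.\<close>

definition mean_on_LUCB :: "(('g::topological_group_add \<Rightarrow> real) \<Rightarrow> real) \<Rightarrow> bool" where
  "mean_on_LUCB m \<longleftrightarrow>
    (\<forall>\<phi>\<in>LUCB. \<forall>\<psi>\<in>LUCB. m (\<lambda>x. \<phi> x + \<psi> x) = m \<phi> + m \<psi>) \<and>
    (\<forall>\<phi>\<in>LUCB. \<forall>c. m (\<lambda>x. c * \<phi> x) = c * m \<phi>) \<and>
    (\<forall>\<phi>\<in>LUCB. (\<forall>x. 0 \<le> \<phi> x) \<longrightarrow> 0 \<le> m \<phi>) \<and>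
    (\<forall>\<phi>\<in>LUCB. \<bar>m \<phi>\<bar> \<le> (SUP x. \<bar>\<phi> x\<bar>)) \<and>
    m (\<lambda>x. 1) = 1"

text \<open>
  Amenability is expressed by an invariant mean; the fixed point property would
  quantify over all locally convex spaces, hence over types.
\<close>

definition amenable :: "'g::topological_group_add itself \<Rightarrow> bool" where
  "amenable G \<longleftrightarrow> (\<exists>m :: ('g \<Rightarrow> real) \<Rightarrow> real. mean_on_LUCB m \<and>
    (\<forall>\<phi>\<in>LUCB. \<forall>g. m (\<lambda>x. \<phi> (x + g)) = m \<phi>))"

definition affine_isometry :: "('v::real_normed_vector \<Rightarrow> 'v) \<Rightarrow> bool" where
  "affine_isometry f \<longleftrightarrow>
    (\<forall>u v t. f ((1 - t) *\<^sub>R u + t *\<^sub>R v) = (1 - t) *\<^sub>R f u + t *\<^sub>R f v) \<and>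
    (\<forall>u v. dist (f u) (f v) = dist u v)"

definition continuous_affine_isometric_action ::
  "('g::topological_group_add \<Rightarrow> 'v::real_normed_vector \<Rightarrow> 'v) \<Rightarrow> bool" where
  "continuous_affine_isometric_action \<alpha> \<longleftrightarrow>
    (\<forall>v. \<alpha> 0 v = v) \<and> (\<forall>g h v. \<alpha> (g + h) v = \<alpha> g (\<alpha> h v)) \<and>
    (\<forall>g. affine_isometry (\<alpha> g)) \<and>
    continuous_on UNIV (\<lambda>(g, v). \<alpha> g v)"

definition linear_isometric_action ::
  "('g::topological_group_add \<Rightarrow> 'v::real_normed_vector \<Rightarrow> 'v) \<Rightarrow> bool" where
  "linear_isometric_action \<pi> \<longleftrightarrow>
    (\<forall>v. \<pi> 0 v = v) \<and> (\<forall>g h v. \<pi> (g + h) v = \<pi> g (\<pi> h v)) \<and>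
    (\<forall>g. linear (\<pi> g) \<and> (\<forall>v. norm (\<pi> g v) = norm v))"

text \<open>The linear part \<open>\<pi>\<close> in the unique decomposition \<open>\<alpha>(g)v = \<pi>(g)v + b(g)\<close>;
  evaluating at \<open>v = 0\<close> forces \<open>b(g) = \<alpha>(g)0\<close>.\<close>

definition linear_part :: "('g \<Rightarrow> 'v::real_vector \<Rightarrow> 'v) \<Rightarrow> 'g \<Rightarrow> 'v \<Rightarrow> 'v" where
  "linear_part \<alpha> g v = \<alpha> g v - \<alpha> g 0"

lemma linear_part_unique:
  assumes "\<And>g. linear (\<pi> g)" and "\<And>g v. \<alpha> g v = \<pi> g v + b g"
  shows "\<pi> = linear_part \<alpha>" and "b = (\<lambda>g. \<alpha> g 0)"
  using assms by (auto simp: fun_eq_iff linear_part_def linear_0)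

lemma affine_isometry_linear_part:
  assumes "affine_isometry f"
  shows "linear (\<lambda>v. f v - f 0)"
proof -
  have aff: "f ((1 - t) *\<^sub>R u + t *\<^sub>R v) = (1 - t) *\<^sub>R f u + t *\<^sub>R f v" for t u v
    using assms by (auto simp: affine_isometry_def)
  have sc: "f (t *\<^sub>R v) - f 0 = t *\<^sub>R (f v - f 0)" for t v
    using aff[of t 0 v] by (simp add: algebra_simps)
  have add: "f (u + v) - f 0 = (f u - f 0) + (f v - f 0)" for u v
  proof -
    have "f (2 *\<^sub>R ((1/2) *\<^sub>R u + (1/2) *\<^sub>R v)) - f 0
        = 2 *\<^sub>R (f ((1/2) *\<^sub>R u + (1/2) *\<^sub>R v) - f 0)"
      by (rule sc)
    also have "f ((1/2) *\<^sub>R u + (1/2) *\<^sub>R v) = (1/2) *\<^sub>R f u + (1/2) *\<^sub>R f v"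
      using aff[of "1/2" u v] by simp
    finally show ?thesis by (simp add: algebra_simps scaleR_2)
  qed
  show ?thesis by (rule linearI) (use sc add in auto)
qed

lemma linear_part_decomposition:
  assumes "continuous_affine_isometric_action \<alpha>"
  shows "linear_isometric_action (linear_part \<alpha>)"
    and "\<And>v. continuous_on UNIV (\<lambda>g. linear_part \<alpha> g v)"
    and "continuous_on UNIV (\<lambda>g. \<alpha> g 0)"
    and "\<And>g v. \<alpha> g v = linear_part \<alpha> g v + \<alpha> g 0"
proof -
  have zero: "\<And>v. \<alpha> 0 v = v" and plus: "\<And>g h v. \<alpha> (g + h) v = \<alpha> g (\<alpha> h v)"
    and iso: "\<And>g. affine_isometry (\<alpha> g)"
    and cont: "continuous_on UNIV (\<lambda>(g, v). \<alpha> g v)"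
    using assms by (auto simp: continuous_affine_isometric_action_def)
  have lin: "linear (linear_part \<alpha> g)" for g
    using affine_isometry_linear_part[OF iso] by (simp add: linear_part_def[abs_def])
  have dec: "\<alpha> g v = linear_part \<alpha> g v + \<alpha> g 0" for g v
    by (simp add: linear_part_def)
  have nrm: "norm (linear_part \<alpha> g v) = norm v" for g v
    using iso[of g] by (auto simp: linear_part_def affine_isometry_def simp flip: dist_norm)
  have act: "linear_part \<alpha> (g + h) v = linear_part \<alpha> g (linear_part \<alpha> h v)" for g h v
  proof -
    have "linear_part \<alpha> g (linear_part \<alpha> h v)
        = linear_part \<alpha> g (\<alpha> h v) - linear_part \<alpha> g (\<alpha> h 0)"
      by (simp add: linear_part_def[of \<alpha> h] linear_diff[OF lin])
    then show ?thesis by (simp add: linear_part_def plus)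
  qed
  show "linear_isometric_action (linear_part \<alpha>)"
    using lin nrm act zero by (auto simp: linear_isometric_action_def linear_part_def)
  have c: "continuous_on UNIV (\<lambda>g. \<alpha> g v)" for v
    using continuous_on_compose2[OF cont, of UNIV "\<lambda>g. (g, v)"]
    by (simp add: continuous_on_Pair continuous_on_const continuous_on_id)
  show "continuous_on UNIV (\<lambda>g. \<alpha> g 0)" by (rule c)
  show "continuous_on UNIV (\<lambda>g. linear_part \<alpha> g v)" for v
    unfolding linear_part_def by (intro continuous_on_diff c)
  show "\<alpha> g v = linear_part \<alpha> g v + \<alpha> g 0" for g v by (rule dec)
qed

text \<open>\<open>'g \<Rightarrow>\<^sub>0 real\<close> is the real group algebra of \<open>'g\<close>, with convolution as multiplication.\<close>

definition \<Delta> :: "('g::topological_group_add \<Rightarrow>\<^sub>0 real) set" where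
  "\<Delta> = {\<beta>. (\<forall>g. 0 \<le> Poly_Mapping.lookup \<beta> g) \<and> (\<Sum>g\<in>Poly_Mapping.keys \<beta>. Poly_Mapping.lookup \<beta> g) = 1}"

definition algebra_action ::
  "('g \<Rightarrow> 'v::real_vector \<Rightarrow> 'v) \<Rightarrow> ('g \<Rightarrow>\<^sub>0 real) \<Rightarrow> 'v \<Rightarrow> 'v" where
  "algebra_action \<pi> \<beta> v = (\<Sum>g\<in>Poly_Mapping.keys \<beta>. Poly_Mapping.lookup \<beta> g *\<^sub>R \<pi> g v)"

definition V_G :: "('g \<Rightarrow> 'v::real_normed_vector \<Rightarrow> 'v) \<Rightarrow> 'v set" where
  "V_G \<pi> = closure (span {v - \<pi> g v | v g. True})"

end

theory Submission
  imports Defs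
begin

text \<open>
  Both non-trivial assertions come from separating a convex set from \<open>0\<close> by a functional
  \<open>\<phi>\<close> of the dual space.

  If \<open>v \<in> V_G\<close> and \<open>0\<close> is not in the closure of \<open>\<pi>(\<Delta>G)v\<close>, separate the latter from \<open>0\<close>
  and average the functions \<open>x \<mapsto> \<phi>(\<pi>(x)w)\<close> with the invariant mean: the result is a bounded
  \<open>\<pi>\<close>-invariant functional of \<open>w\<close>, which vanishes on \<open>V_G\<close> but is positive at \<open>v\<close>.

  If \<open>b(g) \<notin> V_G\<close> for the cocycle \<open>b\<close> of \<open>\<alpha>\<close>, take \<open>\<phi>\<close> vanishing on \<open>V_G\<close> with \<open>\<phi>(b(g)) \<noteq> 0\<close>.
  Then \<open>\<phi>\<close> is \<open>\<pi>\<close>-invariant, so \<open>\<phi> \<circ> b\<close> is a non-zero continuous homomorphism to the reals.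
\<close>

section \<open>Hahn-Banach separation\<close>

text \<open>Homogeneity is only an inequality, which is easy to check for infima; scaling back by
  \<open>inverse c\<close> recovers equality.\<close>

definition sublinear :: "('v::real_vector \<Rightarrow> real) \<Rightarrow> bool" where
  "sublinear p \<longleftrightarrow> (\<forall>x y. p (x + y) \<le> p x + p y) \<and> (\<forall>c>0. \<forall>x. p (c *\<^sub>R x) \<le> c * p x)"

lemma sublinear_add: "sublinear p \<Longrightarrow> p (x + y) \<le> p x + p y"
  by (simp add: sublinear_def)

lemma sublinear_zero:
  assumes "sublinear p"
  shows "p 0 = 0"
proof -
  have *: "c > 0 \<Longrightarrow> p (c *\<^sub>R 0) \<le> c * p 0" for c
    using assms unfolding sublinear_def by blast
  \<comment> \<open>The factor 1/2 yields \<open>p 0 \<le> 0\<close>, the factor 2 yields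
    \<open>0 \<le> p 0\<close>.\<close>
  show ?thesis
    using *[of "1/2"] *[of 2] by simp
qed

lemma sublinear_scaleR:
  assumes "sublinear p" "c \<ge> 0"
  shows "p (c *\<^sub>R x) = c * p x"
proof (cases "c = 0")
  case True
  then show ?thesis by (simp add: sublinear_zero[OF assms(1)])
next
  case False
  then have c: "c > 0" using assms by simp
  have *: "d > 0 \<Longrightarrow> p (d *\<^sub>R y) \<le> d * p y" for d y
    using assms(1) by (simp add: sublinear_def)
  have "p x \<le> inverse c * p (c *\<^sub>R x)"
    using *[of "inverse c" "c *\<^sub>R x"] c by simp
  then have "c * p x \<le> p (c *\<^sub>R x)"
    using c by (simp add: field_simps)
  with *[OF c] show ?thesis by (meson antisym)
qed

lemma sublinear_minus: "sublinear p \<Longrightarrow> - p (- x) \<le> p x"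
  using sublinear_add[of p x "- x"] sublinear_zero[of p] by simp

text \<open>The single \<open>f i\<close> need not be sublinear: it suffices that some member of the
  family lies below each sum and each positive multiple. This serves chains as well as the two
  explicit infima below.\<close>

lemma sublinear_INF:
  assumes ne: "I \<noteq> {}"
    and bdd: "\<And>x. bdd_below ((\<lambda>i. f i x) ` I)"
    and add: "\<And>i j x y. i \<in> I \<Longrightarrow> j \<in> I \<Longrightarrow> \<exists>k\<in>I. f k (x + y) \<le> f i x + f j y"
    and scale: "\<And>i c x. i \<in> I \<Longrightarrow> c > 0 \<Longrightarrow> \<exists>k\<in>I. f k (c *\<^sub>R x) \<le> c * f i x"
  shows "sublinear (\<lambda>x. INF i\<in>I. f i x)"
proof -
  define q where "q = (\<lambda>x. INF i\<in>I. f i x)"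
  have le: "q x \<le> f i x" if "i \<in> I" for i x
    unfolding q_def using bdd that by (rule cINF_lower)
  have ge: "a \<le> q x" if "\<And>i. i \<in> I \<Longrightarrow> a \<le> f i x" for a x
    unfolding q_def using ne that by (rule cINF_greatest)
  have "q (x + y) \<le> q x + q y" for x y
  proof -
    \<comment> \<open>The two infima are taken one after the other: over \<open>j\<close> with
      \<open>i\<close> fixed, then over \<open>i\<close>.\<close>
    have "q (x + y) - f i x \<le> f j y" if "i \<in> I" "j \<in> I" for i j
      using add[OF that, of x y] le by (smt (verit))
    then have "q (x + y) - f i x \<le> q y" if "i \<in> I" for i
      using that by (blast intro: ge)
    then have "q (x + y) - q y \<le> f i x" if "i \<in> I" for i
      using that by (smt (verit))
    then have "q (x + y) - q y \<le> q x" by (rule ge)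
    then show ?thesis by simp
  qed
  moreover have "q (c *\<^sub>R x) \<le> c * q x" if "c > 0" for c x
  proof -
    have "q (c *\<^sub>R x) / c \<le> q x"
    proof (rule ge)
      fix i assume "i \<in> I"
      then have "q (c *\<^sub>R x) \<le> c * f i x"
        using scale[of i c x] le that by (smt (verit))
      then show "q (c *\<^sub>R x) / c \<le> f i x"
        using that by (simp add: field_simps)
    qed
    then show ?thesis using that by (simp add: field_simps)
  qed
  ultimately show ?thesis
    unfolding q_def sublinear_def by blast
qed

text \<open>A sublinear \<open>q\<close> is minimal only if it equals \<open>x \<mapsto> inf\<^sub>t q (x + t y) - t q y\<close> for every \<open>y\<close>,
  which forces superadditivity.\<close>

lemma minimal_sublinear_linear:
  fixes q :: "'v::real_vector \<Rightarrow> real"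
  assumes q: "sublinear q" and min: "\<And>r. sublinear r \<Longrightarrow> r \<le> q \<Longrightarrow> r = q"
  shows "linear q"
proof -
  have add: "q (x + y) = q x + q y" for x y
  proof -
    define f where "f = (\<lambda>t x. q (x + t *\<^sub>R y) - t * q y)"
    define r where "r = (\<lambda>x. INF t\<in>{0..}. f t x)"
    \<comment> \<open>The bound comes from \<open>t * q y = q (t *\<^sub>R y) \<le> q (- x) + q (x +
      t *\<^sub>R y)\<close>.\<close>
    have bdd: "bdd_below ((\<lambda>t. f t x) ` {0..})" for x
    proof (rule bdd_belowI2)
      fix t :: real assume "t \<in> {0..}"
      then show "- q (- x) \<le> f t x"
        using sublinear_add[OF q, of "- x" "x + t *\<^sub>R y"] sublinear_scaleR[OF q, of t y]
        by (simp add: f_def)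
    qed
    have "sublinear r"
      unfolding r_def
    proof (rule sublinear_INF)
      fix s t :: real and x z assume "s \<in> {0..}" "t \<in> {0..}"
      moreover have "f (s + t) (x + z) \<le> f s x + f t z"
        using sublinear_add[OF q, of "x + s *\<^sub>R y" "z + t *\<^sub>R y"]
        by (simp add: f_def algebra_simps)
      ultimately show "\<exists>k\<in>{0..}. f k (x + z) \<le> f s x + f t z"
        by (intro bexI[of _ "s + t"]) auto
    next
      fix t c :: real and x assume "t \<in> {0..}" "c > 0"
      moreover from this have "f (c * t) (c *\<^sub>R x) = c * f t x"
        using sublinear_scaleR[OF q, of c "x + t *\<^sub>R y"]
        by (simp add: f_def algebra_simps)
      ultimately show "\<exists>k\<in>{0..}. f k (c *\<^sub>R x) \<le> c * f t x"
        by (intro bexI[of _ "c * t"]) auto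
    qed (use bdd in auto)
    moreover have r_le: "r x \<le> f t x" if "t \<ge> 0" for t x
      unfolding r_def using bdd that by (intro cINF_lower) auto
    \<comment> \<open>Taking \<open>t = 0\<close> puts \<open>r\<close> below \<open>q\<close>, so
      minimality gives \<open>r = q\<close>; then \<open>t = 1\<close> is superadditivity.\<close>
    have "r \<le> q"
      using r_le[of 0] by (simp add: le_fun_def f_def)
    ultimately have "r = q" by (rule min)
    then have "q x \<le> q (x + y) - q y"
      using r_le[of 1 x] by (simp add: f_def)
    with sublinear_add[OF q, of x y] show ?thesis by simp
  qed
  have minus: "q (- x) = - q x" for x
    using add[of x "- x"] sublinear_zero[OF q] by simp
  have "q (c *\<^sub>R x) = c * q x" for c x
  proof (cases "c \<ge> 0")
    case False
    then show ?thesis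
      using sublinear_scaleR[OF q, of "- c" x] minus[of "c *\<^sub>R x"] by simp
  qed (simp add: sublinear_scaleR[OF q])
  with add show ?thesis by (intro linearI) auto
qed

text \<open>Zorn's lemma gives a minimal sublinear function below \<open>p\<close>, and minimality
  makes it linear.\<close>

lemma sublinear_dominates_linear:
  fixes p :: "'v::real_vector \<Rightarrow> real"
  assumes p: "sublinear p"
  obtains q where "linear q" "q \<le> p"
proof -
  define A where "A = {q. sublinear q \<and> q \<le> p}"
  \<comment> \<open>The order is reversed, so that a maximal element for \<open>P\<close> is a
    minimal function.\<close>
  define P where "P = (\<lambda>q r :: 'v \<Rightarrow> real. r \<le> q)"
  \<comment> \<open>A lower bound common to all of \<open>A\<close> keeps the infimum of a chain
    finite.\<close>
  have lb: "- p (- x) \<le> q x" if "q \<in> A" for q x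
    proof -
    have "q (- x) \<le> p (- x)" "- q (- x) \<le> q x"
      using sublinear_minus[of q x] that by (auto simp: A_def le_fun_def)
    then show ?thesis by simp
  qed
  have "\<exists>m\<in>A. \<forall>a\<in>A. P m a \<longrightarrow> a = m"
  proof (rule predicate_Zorn)
    show "partial_order_on A (relation_of P A)"
      by (rule partial_order_on_relation_ofI) (auto simp: P_def)
  next
    fix C assume C: "C \<in> Chains (relation_of P A)"
    then have sub: "C \<subseteq> A" and tot: "\<And>a b. a \<in> C \<Longrightarrow> b \<in> C \<Longrightarrow> a \<le> b \<or> b \<le> a"
      by (auto simp: Chains_def relation_of_def P_def)
    show "\<exists>u\<in>A. \<forall>a\<in>C. P a u"
    proof (cases "C = {}")
      case True
      then show ?thesis using p by (auto simp: A_def)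
    next
      case False
      define u where "u = (\<lambda>x. INF c\<in>C. c x)"
      have bdd: "bdd_below ((\<lambda>c. c x) ` C)" for x
        using lb sub by (intro bdd_belowI2[of _ "- p (- x)"]) auto
      have u_le: "u \<le> c" if "c \<in> C" for c
        unfolding u_def le_fun_def using bdd that by (auto intro: cINF_lower)
      have "sublinear u"
        unfolding u_def
      proof (rule sublinear_INF[OF False bdd])
        fix c d x y assume cd: "c \<in> C" "d \<in> C"
        \<comment> \<open>The smaller of the two chain members serves as \<open>k\<close>.\<close>
        then obtain k where k: "k \<in> C" "k \<le> c" "k \<le> d"
          using tot[OF cd] by blast
        then have "k (x + y) \<le> k x + k y"
          using sub by (auto simp: A_def intro: sublinear_add)
        also have "\<dots> \<le> c x + d y"
          using k by (intro add_mono) (auto simp: le_fun_def)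
        finally show "\<exists>k\<in>C. k (x + y) \<le> c x + d y"
          using k(1) by blast
      next
        fix c and t :: real and x assume "c \<in> C" "t > 0"
        then show "\<exists>k\<in>C. k (t *\<^sub>R x) \<le> t * c x"
          using sub by (intro bexI[of _ c]) (auto simp: A_def sublinear_def)
      qed
      moreover obtain c where "c \<in> C" using False by blast
      then have "u \<le> c" "c \<le> p" using u_le sub by (auto simp: A_def)
      then have "u \<le> p" by (rule order_trans)
      ultimately show ?thesis
        using u_le by (intro bexI[of _ u]) (auto simp: A_def P_def)
    qed
  qed
  then obtain q where q: "sublinear q" "q \<le> p" and min: "\<And>a. sublinear a \<Longrightarrow> a \<le> p \<Longrightarrow> a \<le> q \<Longrightarrow> a = q"
    by (auto simp: A_def P_def)
  have "linear q"
    using q(1) min[OF _ order_trans[OF _ q(2)]] by (rule minimal_sublinear_linear)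
  with q(2) that show thesis by blast
qed

text \<open>With \<open>d\<close> a positive lower bound for the norm on \<open>C\<close>, the
  infimum of \<open>norm (x + t *\<^sub>R c) - t * d\<close> over \<open>t \<ge> 0\<close> and
  \<open>c \<in> C\<close> is sublinear, at most \<open>norm x\<close> at \<open>x\<close>, and at
  most \<open>- d\<close> at \<open>- c\<close>. Any linear functional below it is therefore bounded
  and at least \<open>d\<close> on \<open>C\<close>.\<close>

lemma separating_functional_closure:
  fixes C :: "'v::real_normed_vector set"
  assumes conv: "convex C" and zero: "0 \<notin> closure C"
  obtains \<phi> :: "'v \<Rightarrow> real" and d
  where "bounded_linear \<phi>" "d > 0" "\<And>c. c \<in> C \<Longrightarrow> d \<le> \<phi> c"
proof (cases "C = {}")
  case True
  then show thesis using that[of "\<lambda>_. 0" 1] by (simp add: bounded_linear_zero)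
next
  case False
  obtain d where d: "d > 0" "\<And>c. c \<in> C \<Longrightarrow> d \<le> norm c"
    using zero unfolding closure_approachable by (auto simp: not_less)
  define I where "I = {0::real..} \<times> C"
  define f where "f = (\<lambda>(t, c) (x :: 'v). norm (x + t *\<^sub>R c) - t * d)"
  have bdd: "bdd_below ((\<lambda>i. f i x) ` I)" for x
  proof (rule bdd_belowI2)
    fix i assume "i \<in> I"
    then obtain t c where i: "i = (t, c)" "t \<ge> 0" "c \<in> C" by (auto simp: I_def)
    have "t * d \<le> norm (t *\<^sub>R c)" using d(2) i by (simp add: mult_left_mono)
    moreover have "norm (t *\<^sub>R c) \<le> norm (x + t *\<^sub>R c) + norm x"
      using norm_triangle_ineq4[of "x + t *\<^sub>R c" x] by simp
    ultimately show "- norm x \<le> f i x" by (simp add: f_def i)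
  qed
  have "sublinear (\<lambda>x. INF i\<in>I. f i x)"
  proof (rule sublinear_INF[OF _ bdd])
    show "I \<noteq> {}" using False by (auto simp: I_def)
  next
    fix i j x y assume "i \<in> I" "j \<in> I"
    then obtain s a t b where ij: "i = (s, a)" "j = (t, b)" "s \<ge> 0" "t \<ge> 0" "a \<in> C" "b \<in> C"
      by (auto simp: I_def)
    \<comment> \<open>Convexity enters here: the normalised combination of \<open>a\<close> and
      \<open>b\<close> stays in \<open>C\<close>. If \<open>s + t = 0\<close>, both sides
      vanish.\<close>
    have "\<exists>c\<in>C. (s + t) *\<^sub>R c = s *\<^sub>R a + t *\<^sub>R b"
    proof (cases "s + t = 0")
      case True
      then show ?thesis using ij by (intro bexI[of _ a]) (auto simp: add_nonneg_eq_0_iff)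
    next
      case False
      then have "(s / (s + t)) *\<^sub>R a + (t / (s + t)) *\<^sub>R b \<in> C"
        using conv ij by (intro convexD) (auto simp: simp flip: add_divide_distrib)
      then show ?thesis
        using False by (rule_tac bexI) (auto simp: scaleR_add_right)
    qed
    then obtain c where c: "c \<in> C" "(s + t) *\<^sub>R c = s *\<^sub>R a + t *\<^sub>R b" by blast
    have "f (s + t, c) (x + y) \<le> f i x + f j y"
      using norm_triangle_ineq[of "x + s *\<^sub>R a" "y + t *\<^sub>R b"]
      by (simp add: f_def ij c(2) distrib_right add_ac)
    then show "\<exists>k\<in>I. f k (x + y) \<le> f i x + f j y"
      using c(1) ij by (intro bexI[of _ "(s + t, c)"]) (auto simp: I_def)
  next
    fix i x and r :: real assume "i \<in> I" "r > 0"
    then obtain t c where i: "i = (t, c)" "t \<ge> 0" "c \<in> C" by (auto simp: I_def)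
    have "norm (r *\<^sub>R x + (r * t) *\<^sub>R c) = r * norm (x + t *\<^sub>R c)"
      using \<open>r > 0\<close> norm_scaleR[of r "x + t *\<^sub>R c"] by (simp add: scaleR_add_right)
    then have "f (r * t, c) (r *\<^sub>R x) = r * f i x"
      by (simp add: f_def i algebra_simps)
    then show "\<exists>k\<in>I. f k (r *\<^sub>R x) \<le> r * f i x"
      using i \<open>r > 0\<close> by (intro bexI[of _ "(r * t, c)"]) (auto simp: I_def)
  qed
  then obtain \<phi> where lin: "linear \<phi>" and "\<phi> \<le> (\<lambda>x. INF i\<in>I. f i x)"
    by (rule sublinear_dominates_linear)
  then have le: "\<phi> x \<le> norm (x + t *\<^sub>R c) - t * d" if "t \<ge> 0" "c \<in> C" for x t c
    using cINF_lower[OF bdd, of "(t, c)" x] that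
    by (auto simp: I_def f_def le_fun_def intro: order_trans)
  obtain c where "c \<in> C" using False by blast
  \<comment> \<open>The parameter \<open>t = 0\<close> bounds the functional; \<open>t = 1\<close>
    at the point \<open>- c\<close> gives the separation.\<close>
  then have "\<phi> x \<le> norm x" for x using le[of 0 c x] by simp
  from this this[of "- x" for x] have "norm (\<phi> x) \<le> norm x * 1" for x
    by (simp add: linear_neg[OF lin] abs_le_iff)
  with lin have "bounded_linear \<phi>"
    by (intro bounded_linear_intro[of \<phi> 1]) (auto simp: linear_add linear_scale)
  moreover have "d \<le> \<phi> c" if "c \<in> C" for c
    using le[of 1 c "- c"] that by (simp add: linear_neg[OF lin])
  ultimately show thesis using that d(1) by blast
qed

section \<open>Orbits and the group algebra\<close>

lemma algebra_action_superset:
  assumes "finite A" "Poly_Mapping.keys \<beta> \<subseteq> A"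
  shows "algebra_action \<pi> \<beta> v = (\<Sum>g\<in>A. Poly_Mapping.lookup \<beta> g *\<^sub>R \<pi> g v)"
  unfolding algebra_action_def
  using assms by (intro sum.mono_neutral_left) (auto simp: in_keys_iff)

text \<open>Convex combinations are formed coefficientwise in the group algebra. Supports may
  differ, so all sums are extended by zeros to the union of both supports.\<close>

lemma convex_algebra_action: "convex ((\<lambda>\<beta>. algebra_action \<pi> \<beta> v) ` \<Delta>)"
proof (rule convexI)
  fix x y and s t :: real
  assume "x \<in> (\<lambda>\<beta>. algebra_action \<pi> \<beta> v) ` \<Delta>" "y \<in> (\<lambda>\<beta>. algebra_action \<pi> \<beta> v) ` \<Delta>"
    and st: "0 \<le> s" "0 \<le> t" "s + t = 1"
  then obtain \<beta> \<gamma> where \<beta>: "\<beta> \<in> \<Delta>" "x = algebra_action \<pi> \<beta> v" and \<gamma>: "\<gamma> \<in> \<Delta>" "y = algebra_action \<pi> \<gamma> v"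
    by blast
  let ?A = "Poly_Mapping.keys \<beta> \<union> Poly_Mapping.keys \<gamma>"
  define \<delta> where
    "\<delta> = Abs_poly_mapping (\<lambda>g. s * Poly_Mapping.lookup \<beta> g + t * Poly_Mapping.lookup \<gamma> g)"
  have "finite {g. s * Poly_Mapping.lookup \<beta> g + t * Poly_Mapping.lookup \<gamma> g \<noteq> 0}"
    by (rule finite_subset[of _ ?A]) (auto simp: in_keys_iff)
  then have lookup: "Poly_Mapping.lookup \<delta> g = s * Poly_Mapping.lookup \<beta> g + t * Poly_Mapping.lookup \<gamma> g" for g
    by (simp add: \<delta>_def)
  then have keys: "Poly_Mapping.keys \<delta> \<subseteq> ?A"
    by (auto simp: in_keys_iff)
  have total: "(\<Sum>g\<in>Poly_Mapping.keys \<epsilon>. Poly_Mapping.lookup \<epsilon> g) = (\<Sum>g\<in>?A. Poly_Mapping.lookup \<epsilon> g)"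
    if "Poly_Mapping.keys \<epsilon> \<subseteq> ?A" for \<epsilon>
    using that by (intro sum.mono_neutral_left) (auto simp: in_keys_iff)
  have "\<delta> \<in> \<Delta>"
    using \<beta>(1) \<gamma>(1) st total[OF keys] total[of \<beta>] total[of \<gamma>]
    by (auto simp: \<Delta>_def lookup sum.distrib simp flip: sum_distrib_left)
  moreover have "algebra_action \<pi> \<delta> v = s *\<^sub>R x + t *\<^sub>R y"
    by (simp add: \<beta>(2) \<gamma>(2) algebra_action_superset[of ?A] keys lookup scaleR_add_left
        sum.distrib scaleR_sum_right)
  ultimately show "s *\<^sub>R x + t *\<^sub>R y \<in> (\<lambda>\<beta>. algebra_action \<pi> \<beta> v) ` \<Delta>"
    by (metis image_eqI)
qed

text \<open>The point mass at \<open>g\<close> is the witness; thus a lower bound on all averages of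
  \<open>v\<close> holds along its orbit.\<close>

lemma orbit_in_algebra_action: "\<pi> g v \<in> (\<lambda>\<beta>. algebra_action \<pi> \<beta> v) ` \<Delta>"
proof (rule image_eqI)
  show "Poly_Mapping.single g 1 \<in> \<Delta>"
    by (auto simp: \<Delta>_def lookup_single when_def)
qed (simp add: algebra_action_def)

section \<open>The closed subspace spanned by the differences \<open>v - \<pi> g v\<close>\<close>

lemma subspace_closure:
  fixes S :: "'v::real_normed_vector set"
  assumes S: "subspace S"
  shows "subspace (closure S)"
proof (rule subspaceI)
  show "0 \<in> closure S"
    using subspace_0[OF S] closure_subset by blast
next
  fix x y assume "x \<in> closure S" "y \<in> closure S"
  then obtain f g where "\<And>n. f n \<in> S" "f \<longlonglongrightarrow> x" "\<And>n. g n \<in> S" "g \<longlonglongrightarrow> y"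
    by (auto simp: closure_sequential)
  then show "x + y \<in> closure S"
    unfolding closure_sequential
    by (intro exI[of _ "\<lambda>n. f n + g n"]) (auto intro: tendsto_add subspace_add[OF S])
next
  fix c x assume "x \<in> closure S"
  then obtain f where "\<And>n. f n \<in> S" "f \<longlonglongrightarrow> x"
    by (auto simp: closure_sequential)
  then show "c *\<^sub>R x \<in> closure S"
    unfolding closure_sequential
    by (intro exI[of _ "\<lambda>n. c *\<^sub>R f n"]) (auto intro: tendsto_scaleR subspace_scale[OF S])
qed

lemma subspace_V_G: "subspace (V_G \<pi>)"
  unfolding V_G_def by (intro subspace_closure subspace_span)

lemma diff_orbit_in_V_G: "v - \<pi> g v \<in> V_G \<pi>"
  unfolding V_G_def by (intro closure_subset[THEN subsetD] span_base) blast

text \<open>Invariance kills the generators, linearity their span, and continuity its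
  closure.\<close>

lemma bounded_linear_vanishes_on_V_G:
  fixes \<psi> :: "'v::real_normed_vector \<Rightarrow> real"
  assumes \<psi>: "bounded_linear \<psi>" and inv: "\<And>g v. \<psi> (\<pi> g v) = \<psi> v" and "w \<in> V_G \<pi>"
  shows "\<psi> w = 0"
proof -
  have lin: "linear \<psi>" using \<psi> by (rule bounded_linear.linear)
  have "\<psi> w = 0" if "w \<in> span {v - \<pi> g v | v g. True}" for w
  proof (rule linear_eq_0_on_span[OF lin _ that])
    fix x assume "x \<in> {v - \<pi> g v | v g. True}"
    then obtain v g where "x = v - \<pi> g v" by blast
    then show "\<psi> x = 0" by (simp add: inv linear_diff[OF lin])
  qed
  then show ?thesis
    using \<open>w \<in> V_G \<pi>\<close> unfolding V_G_def
    by (rule continuous_constant_on_closure[OF bounded_linear.continuous_on[OF \<psi> continuous_on_id]])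
qed

lemma zero_in_closure_imp_V_G:
  assumes "0 \<in> closure ((\<lambda>\<beta>. algebra_action \<pi> \<beta> v) ` \<Delta>)"
  shows "v \<in> V_G \<pi>"
proof -
  let ?S = "span {v - \<pi> g v | v g. True}"
  have "\<exists>w\<in>?S. dist w v < e" if "e > 0" for e
  proof -
    obtain \<beta> where \<beta>: "\<beta> \<in> \<Delta>" "norm (algebra_action \<pi> \<beta> v) < e"
      using assms \<open>e > 0\<close> by (auto simp: closure_approachable)
    \<comment> \<open>As the weights sum to 1, \<open>v\<close> can be moved inside the sum. This
      element of the span differs from \<open>v\<close> by an average of norm below
      \<open>e\<close>.\<close>
    have "v - algebra_action \<pi> \<beta> v = (\<Sum>g\<in>Poly_Mapping.keys \<beta>. Poly_Mapping.lookup \<beta> g *\<^sub>R (v - \<pi> g v))"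
      using \<beta>(1) by (simp add: algebra_action_def \<Delta>_def scaleR_diff_right sum_subtractf
          flip: scaleR_sum_left)
    also have "\<dots> \<in> ?S"
      by (intro span_sum span_scale span_base) blast
    finally show ?thesis
      using \<beta>(2) by (intro bexI[of _ "v - algebra_action \<pi> \<beta> v"]) (auto simp: dist_norm)
  qed
  then show ?thesis by (simp add: V_G_def closure_approachable)
qed

section \<open>Averaging with an invariant mean\<close>

lemma const_in_LUCB: "(\<lambda>_. c) \<in> LUCB"
  by (simp add: LUCB_def uniform_limit_const)

lemma LUCB_add:
  assumes "\<phi> \<in> LUCB" "\<psi> \<in> LUCB"
  shows "(\<lambda>x. \<phi> x + \<psi> x) \<in> LUCB"
  using assms by (auto simp: LUCB_def intro: bounded_plus_comp uniform_limit_add)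

text \<open>Since \<open>\<pi> x\<close> is isometric, translates by \<open>h\<close> and
  \<open>g\<close> differ at \<open>x\<close> by at most
  \<open>K * norm (\<pi> h w - \<pi> g w)\<close>. This is independent of \<open>x\<close>, so
  continuity of the orbit map gives uniform convergence.\<close>

lemma matrix_coefficient_in_LUCB:
  fixes \<phi> :: "'v::real_normed_vector \<Rightarrow> real"
  assumes \<pi>: "linear_isometric_action \<pi>" and cont: "continuous_on UNIV (\<lambda>g. \<pi> g w)"
    and \<phi>: "bounded_linear \<phi>"
  shows "(\<lambda>x. \<phi> (\<pi> x w)) \<in> LUCB"
proof -
  obtain K where K: "K > 0" "\<And>v. norm (\<phi> v) \<le> norm v * K"
    using bounded_linear.pos_bounded[OF \<phi>] by blast
  have lin: "\<And>g. linear (\<pi> g)" and iso: "\<And>g v. norm (\<pi> g v) = norm v"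
    and act: "\<And>g h v. \<pi> (g + h) v = \<pi> g (\<pi> h v)"
    using \<pi> by (auto simp: linear_isometric_action_def)
  have "bounded (range (\<lambda>x. \<phi> (\<pi> x w)))"
    using K(2)[of "\<pi> x w" for x] by (auto simp: iso intro!: boundedI)
  moreover have "uniform_limit UNIV (\<lambda>h x. \<phi> (\<pi> (x + h) w)) (\<lambda>x. \<phi> (\<pi> (x + g) w)) (nhds g)" for g
  proof (rule uniform_limitI)
    fix e :: real assume "e > 0"
    have "((\<lambda>h. \<pi> h w) \<longlongrightarrow> \<pi> g w) (nhds g)"
      using cont by (simp add: continuous_on_def tendsto_at_iff_tendsto_nhds[of "\<lambda>h. \<pi> h w"])
    then have "\<forall>\<^sub>F h in nhds g. dist (\<pi> h w) (\<pi> g w) < e / K"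
      using \<open>e > 0\<close> K(1) by (simp add: tendsto_iff)
    then show "\<forall>\<^sub>F h in nhds g. \<forall>x\<in>UNIV. dist (\<phi> (\<pi> (x + h) w)) (\<phi> (\<pi> (x + g) w)) < e"
    proof eventually_elim
      case (elim h)
      have "dist (\<phi> (\<pi> (x + h) w)) (\<phi> (\<pi> (x + g) w)) \<le> dist (\<pi> h w) (\<pi> g w) * K" for x
        using K(2)[of "\<pi> x (\<pi> h w - \<pi> g w)", unfolded iso]
        by (simp add: dist_norm act linear_diff[OF lin] linear_diff[OF bounded_linear.linear[OF \<phi>]])
      moreover have "dist (\<pi> h w) (\<pi> g w) * K < e"
        using elim K(1) by (simp add: field_simps)
      ultimately show ?case by (auto intro: le_less_trans)
    qed
  qed
  ultimately show ?thesis by (simp add: LUCB_def)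
qed

lemma amenable_invariant_functional:
  fixes \<pi> :: "'g::topological_group_add \<Rightarrow> 'v::real_normed_vector \<Rightarrow> 'v" and \<phi> :: "'v \<Rightarrow> real"
  assumes am: "amenable TYPE('g)" and \<pi>: "linear_isometric_action \<pi>"
    and cont: "\<And>w. continuous_on UNIV (\<lambda>g. \<pi> g w)" and \<phi>: "bounded_linear \<phi>"
  obtains \<psi> :: "'v \<Rightarrow> real" where "bounded_linear \<psi>" "\<And>g w. \<psi> (\<pi> g w) = \<psi> w"
    "\<And>w d. (\<And>g. d \<le> \<phi> (\<pi> g w)) \<Longrightarrow> d \<le> \<psi> w"
proof -
  obtain m :: "('g \<Rightarrow> real) \<Rightarrow> real" where m: "mean_on_LUCB m"
    and inv: "\<And>f g. f \<in> LUCB \<Longrightarrow> m (\<lambda>x. f (x + g)) = m f"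
    using am by (auto simp: amenable_def)
  have madd: "m (\<lambda>x. f x + h x) = m f + m h" if "f \<in> LUCB" "h \<in> LUCB" for f h
    using m that by (simp add: mean_on_LUCB_def)
  have mscale: "m (\<lambda>x. c * f x) = c * m f" if "f \<in> LUCB" for f c
    using m that by (simp add: mean_on_LUCB_def)
  have mpos: "0 \<le> m f" if "f \<in> LUCB" "\<And>x. 0 \<le> f x" for f
    using m that by (simp add: mean_on_LUCB_def)
  have mnorm: "\<bar>m f\<bar> \<le> (SUP x. \<bar>f x\<bar>)" if "f \<in> LUCB" for f
    using m that by (simp add: mean_on_LUCB_def)
  have mconst: "m (\<lambda>_. c) = c" for c
    using mscale[OF const_in_LUCB, of c 1] m by (simp add: mean_on_LUCB_def)
  have lin: "\<And>g. linear (\<pi> g)" and iso: "\<And>g v. norm (\<pi> g v) = norm v"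
    and act: "\<And>g h v. \<pi> (g + h) v = \<pi> g (\<pi> h v)"
    using \<pi> by (auto simp: linear_isometric_action_def)
  have lin\<phi>: "linear \<phi>" using \<phi> by (rule bounded_linear.linear)
  obtain K where K: "\<And>v. norm (\<phi> v) \<le> norm v * K"
    using bounded_linear.bounded[OF \<phi>] by blast
  \<comment> \<open>The mean of the matrix coefficient is linear in \<open>w\<close>, and its norm
    bound comes from that of \<open>m\<close>.\<close>
  define \<psi> where "\<psi> = (\<lambda>w. m (\<lambda>x. \<phi> (\<pi> x w)))"
  note coeff = matrix_coefficient_in_LUCB[OF \<pi> cont \<phi>]
  have "bounded_linear \<psi>"
  proof (rule bounded_linear_intro[of \<psi> K])
    show "\<psi> (v + w) = \<psi> v + \<psi> w" for v w
      using madd[OF coeff[of v] coeff[of w]] by (simp add: \<psi>_def linear_add[OF lin] linear_add[OF lin\<phi>])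
    show "\<psi> (c *\<^sub>R w) = c *\<^sub>R \<psi> w" for c w
      using mscale[OF coeff[of w], of c] by (simp add: \<psi>_def linear_scale[OF lin] linear_scale[OF lin\<phi>])
    show "norm (\<psi> w) \<le> norm w * K" for w
    proof -
      have "(SUP x. \<bar>\<phi> (\<pi> x w)\<bar>) \<le> norm w * K"
        using K[of "\<pi> x w" for x] by (intro cSUP_least) (auto simp: iso)
      with mnorm[OF coeff[of w]] show ?thesis by (simp add: \<psi>_def)
    qed
  qed
  \<comment> \<open>By \<open>\<pi> x (\<pi> g w) = \<pi> (x + g) w\<close>, the coefficient of
    \<open>\<pi> g w\<close> is the right translate by \<open>g\<close> of that of
    \<open>w\<close>.\<close>
  moreover have "\<psi> (\<pi> g w) = \<psi> w" for g w
    using inv[OF coeff[of w], of g] by (simp add: \<psi>_def act)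
  \<comment> \<open>Positivity of \<open>m\<close> is applied to the coefficient minus the constant
    \<open>d\<close>.\<close>
  moreover have "d \<le> \<psi> w" if "\<And>g. d \<le> \<phi> (\<pi> g w)" for w d
    using mpos[OF LUCB_add[OF coeff[of w] const_in_LUCB[of "- d"]]] that
      madd[OF coeff[of w] const_in_LUCB[of "- d"]] by (simp add: \<psi>_def mconst)
  ultimately show thesis by (rule that)
qed

lemma V_G_imp_zero_in_closure:
  fixes \<pi> :: "'g::topological_group_add \<Rightarrow> 'v::real_normed_vector \<Rightarrow> 'v"
  assumes am: "amenable TYPE('g)" and \<pi>: "linear_isometric_action \<pi>"
    and cont: "\<And>w. continuous_on UNIV (\<lambda>g. \<pi> g w)" and v: "v \<in> V_G \<pi>"
  shows "0 \<in> closure ((\<lambda>\<beta>. algebra_action \<pi> \<beta> v) ` \<Delta>)"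
proof (rule ccontr)
  assume "\<not> ?thesis"
  then obtain \<phi> :: "'v \<Rightarrow> real" and d where \<phi>: "bounded_linear \<phi>" and d: "d > 0"
    and ge: "\<And>c. c \<in> (\<lambda>\<beta>. algebra_action \<pi> \<beta> v) ` \<Delta> \<Longrightarrow> d \<le> \<phi> c"
    by (rule separating_functional_closure[OF convex_algebra_action]) blast
  obtain \<psi> :: "'v \<Rightarrow> real" where \<psi>: "bounded_linear \<psi>" "\<And>g w. \<psi> (\<pi> g w) = \<psi> w"
    and ge_\<psi>: "\<And>w d. (\<And>g. d \<le> \<phi> (\<pi> g w)) \<Longrightarrow> d \<le> \<psi> w"
    by (rule amenable_invariant_functional[OF am \<pi> cont \<phi>]) blast
  have "\<psi> v = 0"
    using \<psi> v by (rule bounded_linear_vanishes_on_V_G)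
  moreover have "d \<le> \<psi> v"
    by (intro ge_\<psi> ge orbit_in_algebra_action)
  ultimately show False using d by simp
qed

section \<open>The cocycle\<close>

lemma cocycle_in_V_G:
  fixes \<pi> :: "'g::topological_group_add \<Rightarrow> 'v::real_normed_vector \<Rightarrow> 'v"
  assumes hom: "\<And>f :: 'g \<Rightarrow> real. continuous_on UNIV f \<Longrightarrow> (\<And>g h. f (g + h) = f g + f h) \<Longrightarrow> f = (\<lambda>g. 0)"
    and cont: "continuous_on UNIV b"
    and cocycle: "\<And>g h. b (g + h) = \<pi> g (b h) + b g"
  shows "b g \<in> V_G \<pi>"
proof (rule ccontr)
  assume notin: "b g \<notin> V_G \<pi>"
  \<comment> \<open>The convex set to separate from 0 is the closed coset of \<open>b g\<close>,
    which misses 0 because \<open>V_G \<pi>\<close> contains negatives.\<close>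
  have "closure ((+) (b g) ` V_G \<pi>) = (+) (b g) ` V_G \<pi>"
    by (simp add: closure_translation V_G_def)
  moreover have "0 \<notin> (+) (b g) ` V_G \<pi>"
    using notin subspace_neg[OF subspace_V_G, of _ \<pi>]
    by (force simp: eq_neg_iff_add_eq_0[symmetric])
  ultimately have "0 \<notin> closure ((+) (b g) ` V_G \<pi>)" by simp
  then obtain \<phi> :: "'v \<Rightarrow> real" and d where \<phi>: "bounded_linear \<phi>" and d: "d > 0"
    and ge': "\<And>c. c \<in> (+) (b g) ` V_G \<pi> \<Longrightarrow> d \<le> \<phi> c"
    by (rule separating_functional_closure[OF convex_translation[OF subspace_imp_convex[OF subspace_V_G]]]) blast
  have ge: "d \<le> \<phi> (b g + w)" if "w \<in> V_G \<pi>" for w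
    using that by (intro ge') blast
  have lin: "linear \<phi>" using \<phi> by (rule bounded_linear.linear)
  \<comment> \<open>If \<open>\<phi> w\<close> were non-zero, moving from \<open>b g\<close> along a
    multiple of \<open>w\<close> would reach a zero of \<open>\<phi>\<close> inside the
    coset.\<close>
  have vanish: "\<phi> w = 0" if w: "w \<in> V_G \<pi>" for w
  proof (rule ccontr)
    assume "\<phi> w \<noteq> 0"
    then have "\<phi> (b g + (- (\<phi> (b g) / \<phi> w)) *\<^sub>R w) = 0"
      by (simp add: linear_diff[OF lin] linear_scale[OF lin])
    then show False
      using ge[OF subspace_scale[OF subspace_V_G w]] d by (metis not_less)
  qed
  have inv: "\<phi> (\<pi> h v) = \<phi> v" for h v
    using vanish[OF diff_orbit_in_V_G[of v \<pi> h]] by (simp add: linear_diff[OF lin])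
  \<comment> \<open>Applying the invariant \<open>\<phi>\<close> to the cocycle identity removes
    \<open>\<pi> g\<close> and leaves additivity.\<close>
  have "(\<lambda>h. \<phi> (b h)) = (\<lambda>h. 0)"
  proof (rule hom)
    show "continuous_on UNIV (\<lambda>h. \<phi> (b h))"
      using \<phi> cont by (rule bounded_linear.continuous_on)
  qed (simp add: cocycle linear_add[OF lin] inv)
  then have "\<phi> (b g) = 0" by (rule fun_cong)
  then show False
    using ge[OF subspace_0[OF subspace_V_G]] d by simp
qed

theorem theorem1p7:
  fixes \<alpha> \<pi> :: "'g::topological_group_add \<Rightarrow> 'v::banach \<Rightarrow> 'v"
  assumes "amenable TYPE('g)"
    and "\<And>f :: 'g \<Rightarrow> real. continuous_on UNIV f \<Longrightarrow> (\<And>g h. f (g + h) = f g + f h) \<Longrightarrow> f = (\<lambda>g. 0)"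
    and "continuous_affine_isometric_action \<alpha>"
    and "\<pi> = linear_part \<alpha>"
  shows "V_G \<pi> = {v. 0 \<in> closure ((\<lambda>\<beta>. algebra_action \<pi> \<beta> v) ` \<Delta>)}
    \<and> closed (V_G \<pi>) \<and> subspace (V_G \<pi>) \<and> (\<forall>g. \<alpha> g ` V_G \<pi> \<subseteq> V_G \<pi>)"
proof -
  note dec = linear_part_decomposition[OF assms(3), folded assms(4)]
  have "\<alpha> (g + h) 0 = \<pi> g (\<alpha> h 0) + \<alpha> g 0" for g h
    using assms(3) dec(4)[of g "\<alpha> h 0"] by (simp add: continuous_affine_isometric_action_def)
  then have cocycle: "\<alpha> g 0 \<in> V_G \<pi>" for g
    using cocycle_in_V_G[of "\<lambda>g. \<alpha> g 0" \<pi>] assms(2) dec(3) by blast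
  have "\<alpha> g v \<in> V_G \<pi>" if v: "v \<in> V_G \<pi>" for g v
  proof -
    \<comment> \<open>This is \<open>\<alpha> g v\<close>, rewritten with summands that all lie in
      \<open>V_G \<pi>\<close>.\<close>
    have "v - (v - \<pi> g v) + \<alpha> g 0 \<in> V_G \<pi>"
      by (intro subspace_add[OF subspace_V_G] subspace_diff[OF subspace_V_G] v diff_orbit_in_V_G cocycle)
    then show ?thesis using dec(4)[of g v] by simp
  qed
  moreover have "V_G \<pi> = {v. 0 \<in> closure ((\<lambda>\<beta>. algebra_action \<pi> \<beta> v) ` \<Delta>)}"
    using V_G_imp_zero_in_closure[OF assms(1) dec(1,2)] zero_in_closure_imp_V_G by blast
  moreover have "closed (V_G \<pi>)"
    by (simp add: V_G_def)
  ultimately show ?thesis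
    using subspace_V_G by blast
qed

end
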